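(* Let $\{\mu_n\}_{n\in\mathbb{N}} \cup \{\mu\} \subset \mathcal{M}_{\Psi}$ be such that for every $\lambda > 0$, $$\limsup_{n \to \infty} \Psi_{|\mu_n|}(\lambda) < \infty .$$ (a) Suppose $\Psi_{\mu_n}(\lambda) \to \Psi_\mu(\lambda)$ as $n\to\infty$ for all $\lambda > 0$. If $\{\mu_n\}$ is right-equicontinuous at a continuity point $x \in \mathbb{R}_{+}$ of $\mu$, then $F_{\mu_n}(x) \to F_\mu(x)$ as $n\to\infty$. (b) If $F_{\mu_n} \to F_\mu$ almost everywhere on $\mathbb{R}_+$ (with respect to Lebesgue measure), then $\Psi_{\mu_n}(\lambda) \to \Psi_{\mu}(\lambda)$ as $n \to \infty$ for all $\lambda>0$.
   Context: $\mathbb{R}_+ := [0,\infty)$ with Borel $\sigma$-algebra $\mathscr{B}(\mathbb{R}_+)$. A positive Borel measure on $\mathbb{R}_+$ is a Radon measure if it is locally finite (every point has an open neighbourhood in $\mathbb{R}_+$ of finite measure) and inner regular (the measure of each Borel set is the supremum of the measures of its compact subsets). A mapping $\mu:\mathscr{B}(\mathbb{R}_+)\to\mathbb{R}\cup\{\infty\}$ is a generalised signed Radon measure if there exist mutually singular (positive) Radon measures $\mu^+$ and $\mu^-$ on $\mathbb{R}_+$ such that for each $A\in\mathscr{B}(\mathbb{R}_+)$, $\mu(A)=\mu^+(A)-\mu^-(A)$ if both $\mu^+(A),\mu^-(A)<\infty$, and $\mu(A)=+\infty$ otherwise. (Both $\mu^+$ and $\mu^-$ may have infinite total mass.) Set $|\mu|:=\mu^++\mu^-$.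 Integrals are $\int f\,\mathrm{d}\mu=\int f\,\mathrm{d}\mu^+-\int f\,\mathrm{d}\mu^-$ for $|\mu|$-integrable $f$. Let $\mathcal{M}^*$ be the space of all generalised signed Radon measures on $\mathbb{R}_+$. For $\mu\in\mathcal{M}^*$, the distribution function $F_\mu:\mathbb{R}_+\to\mathbb{R}$ is defined by $F_\mu(0):=0$ and $F_\mu(x):=\mu([0,x])$ for $x>0$. $\mathcal{M}_\Psi:=\{\mu\in\mathcal{M}^*:\int_{\mathbb{R}_+}e^{-\lambda x}\,|\mu|(\mathrm{d}x)<\infty\text{ for all }\lambda>0\}$. For $\mu\in\mathcal{M}_\Psi$, its Laplace transform is $\Psi_\mu(\lambda):=\int_{\mathbb{R}_+}e^{-\lambda x}\,\mu(\mathrm{d}x)$, $\lambda>0$; likewise $\Psi_{|\mu|}(\lambda)=\int_{\mathbb{R}_+}e^{-\lambda x}\,|\mu|(\mathrm{d}x)$. A sequence $\{\mu_n\}\subset\mathcal{M}^*$ is right-equicontinuous at a point $x\in\mathbb{R}_+$ if for every $\varepsilon>0$ there exists $h>0$ such that for all $0<\delta<h$, $\limsup_{n\to\infty}|\mu_n((x,x+\delta])|\le\varepsilon$. A continuity point of $\mu$ is a point $x\in\mathbb{R}_+$ with $\mu(\{x\})=0$. *)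

theory Defs
  imports "HOL-Analysis.Analysis"
begin

abbreviation borel_nonneg :: "real measure" where
  "borel_nonneg \<equiv> restrict_space borel {0..}"

definition radon_measure :: "real measure \<Rightarrow> bool" where
  "radon_measure M \<longleftrightarrow>
     sets M = sets borel_nonneg \<and>
     (\<forall>x\<in>{0..}. \<exists>U. openin (top_of_set {0..}) U \<and> x \<in> U \<and> emeasure M U < \<infinity>) \<and>
     (\<forall>A\<in>sets M. emeasure M A = (SUP K\<in>{K. K \<subseteq> A \<and> compact K}. emeasure M K))"

definition mutually_singular :: "'a measure \<Rightarrow> 'a measure \<Rightarrow> bool" where
  "mutually_singular M N \<longleftrightarrow>
     (\<exists>H\<in>sets M. emeasure N H = 0 \<and> emeasure M (space M - H) = 0)"

text \<open>A mapping on the Borel sets of the half-line is represented by a total function on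
  \<^typ>\<open>real set\<close>, whose values at all other sets are irrelevant and never used.\<close>

definition jordan_pair :: "(real set \<Rightarrow> ereal) \<Rightarrow> real measure \<Rightarrow> real measure \<Rightarrow> bool" where
  "jordan_pair \<mu> P N \<longleftrightarrow>
     radon_measure P \<and> radon_measure N \<and> mutually_singular P N \<and>
     (\<forall>A\<in>sets borel_nonneg.
        \<mu> A = (if emeasure P A < \<infinity> \<and> emeasure N A < \<infinity>
               then ereal (measure P A - measure N A) else \<infinity>))"

definition gen_signed_radon :: "(real set \<Rightarrow> ereal) \<Rightarrow> bool" where
  "gen_signed_radon \<mu> \<longleftrightarrow> (\<exists>P N. jordan_pair \<mu> P N)"

definition jordan_decomp :: "(real set \<Rightarrow> ereal) \<Rightarrow> real measure \<times> real measure" where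
  "jordan_decomp \<mu> = (THE (P, N). jordan_pair \<mu> P N)"

definition pos_part :: "(real set \<Rightarrow> ereal) \<Rightarrow> real measure" where
  "pos_part \<mu> = fst (jordan_decomp \<mu>)"

definition neg_part :: "(real set \<Rightarrow> ereal) \<Rightarrow> real measure" where
  "neg_part \<mu> = snd (jordan_decomp \<mu>)"

text \<open>The following lemmas show that the definite description above is well-defined.\<close>

lemma mutually_singular_sym:
  assumes "sets M = sets N" "mutually_singular M N"
  shows "mutually_singular N M"
proof -
  obtain H where H: "H \<in> sets M" "emeasure N H = 0" "emeasure M (space M - H) = 0"
    using assms(2) by (auto simp: mutually_singular_def)
  have "space N = space M" using assms(1) sets_eq_imp_space_eq by metis
  moreover have "space M - (space M - H) = H"
    using sets.sets_into_space[OF H(1)] by blast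
  ultimately show ?thesis
    unfolding mutually_singular_def
    using H assms(1) by (intro bexI[of _ "space M - H"]) auto
qed

lemma sets_radon_measure: "radon_measure M \<Longrightarrow> sets M = sets borel_nonneg"
  by (simp add: radon_measure_def)

lemma space_radon_measure: "radon_measure M \<Longrightarrow> space M = {0..}"
  by (metis radon_measure_def sets_eq_imp_space_eq Int_UNIV_right
      space_borel space_restrict_space)

lemma radon_measure_finite_on_compact:
  assumes M: "radon_measure M" and K: "compact K" "K \<subseteq> {0..}"
  shows "emeasure M K < \<infinity>"
proof -
  have "\<forall>x\<in>K. \<exists>V. open V \<and> x \<in> V \<and> emeasure M ({0..} \<inter> V) < \<infinity>"
  proof
    fix x assume "x \<in> K"
    then obtain U where U: "openin (top_of_set {0..}) U" "x \<in> U" "emeasure M U < \<infinity>"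
      using M K(2) unfolding radon_measure_def by blast
    then show "\<exists>V. open V \<and> x \<in> V \<and> emeasure M ({0..} \<inter> V) < \<infinity>"
      by (metis IntD2 openin_open)
  qed
  then obtain V where V: "\<And>x. x \<in> K \<Longrightarrow> open (V x) \<and> x \<in> V x \<and> emeasure M ({0..} \<inter> V x) < \<infinity>"
    by metis
  obtain C where C: "C \<subseteq> K" "finite C" "K \<subseteq> (\<Union>c\<in>C. V c)"
    using compactE_image[OF K(1), of K V] V by blast
  have meas: "{0..} \<inter> V c \<in> sets M" if "c \<in> C" for c
  proof -
    have "open (V c)" using V C(1) that by blast
    then show ?thesis
      using M unfolding radon_measure_def by (simp add: sets_restrict_space_iff)
  qed
  have "emeasure M K \<le> emeasure M (\<Union>c\<in>C. {0..} \<inter> V c)"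
    using C(2,3) K(2) meas by (intro emeasure_mono sets.finite_UN) auto
  also have "\<dots> \<le> (\<Sum>c\<in>C. emeasure M ({0..} \<inter> V c))"
    using C(2) meas by (intro emeasure_subadditive_finite) auto
  also have "\<dots> < \<infinity>"
    using C V by (auto simp: less_top)
  finally show ?thesis .
qed

lemma jordan_pair_le:
  assumes J: "jordan_pair \<mu> P N" "jordan_pair \<mu> P' N'"
    and A: "A \<in> sets borel_nonneg" "A \<subseteq> {0..real n}"
  shows "emeasure P A \<le> emeasure P' A" "emeasure N A \<le> emeasure N' A"
proof -
  have R: "radon_measure P" "radon_measure N" "radon_measure P'" "radon_measure N'"
    using J by (auto simp: jordan_pair_def)
  note [simp] = space_radon_measure[OF R(1)] space_radon_measure[OF R(2)]
  have S [simp]: "sets P = sets borel_nonneg" "sets N = sets borel_nonneg"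
    "sets P' = sets borel_nonneg" "sets N' = sets borel_nonneg"
    using R by (auto simp: sets_radon_measure)
  have I: "{0..real n} \<in> sets borel_nonneg" by (auto simp: sets_restrict_space_iff)
  have fin: "emeasure M B < \<infinity>" if "radon_measure M" "B \<subseteq> A" for M B
  proof -
    have "emeasure M B \<le> emeasure M {0..real n}"
      using that A I by (intro emeasure_mono) (auto simp: sets_radon_measure)
    also have "\<dots> < \<infinity>"
      using that(1) by (rule radon_measure_finite_on_compact) auto
    finally show ?thesis .
  qed
  have val: "measure P B - measure N B = measure P' B - measure N' B"
    if "B \<in> sets borel_nonneg" "B \<subseteq> A" for B
    using J that fin[OF R(1)] fin[OF R(2)] fin[OF R(3)] fin[OF R(4)]
    by (auto simp: jordan_pair_def)
  obtain H where H: "H \<in> sets borel_nonneg" "emeasure N H = 0" "emeasure P ({0..} - H) = 0"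
    using J(1) by (auto simp: jordan_pair_def mutually_singular_def)
  have meas: "measure M B \<le> measure M A"
    if "radon_measure M" "B \<in> sets borel_nonneg" "B \<subseteq> A" for M B
    using that A fin[OF that(1), of A]
    by (intro measure_mono_fmeasurable)
       (auto simp: sets_radon_measure fmeasurable_def)
  have Hc: "{0..} - H \<in> sets borel_nonneg" using H(1) S(1) sets.compl_sets[of H P] by simp
  have AH: "A \<inter> H \<in> sets borel_nonneg" "A - H \<in> sets borel_nonneg" using A H by auto
  have "emeasure P (A - H) = 0" "emeasure N (A \<inter> H) = 0"
  proof -
    have "A - H \<subseteq> {0..} - H" using A(2) by auto
    then show "emeasure P (A - H) = 0"
      by (rule emeasure_eq_0[rotated 2]) (use H Hc S in simp_all)
    show "emeasure N (A \<inter> H) = 0"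
      by (rule emeasure_eq_0[where N=H]) (use H S in simp_all)
  qed
  then have z: "measure P (A - H) = 0" "measure N (A \<inter> H) = 0" by (auto simp: measure_def)
  have split: "measure M A = measure M (A \<inter> H) + measure M (A - H)"
    if "radon_measure M" for M
  proof -
    have "measure M ((A \<inter> H) \<union> (A - H)) = measure M (A \<inter> H) + measure M (A - H)"
      using that AH fin[OF that, of "A \<inter> H"] fin[OF that, of "A - H"]
      by (intro measure_Union) (auto simp: sets_radon_measure less_top)
    then show ?thesis by (simp add: Int_Diff_Un)
  qed
  have "measure P A = measure P' (A \<inter> H) - measure N' (A \<inter> H)"
    using split[OF R(1)] z val[OF AH(1)] by simp
  also have "\<dots> \<le> measure P' A"
    using meas[OF R(3) AH(1) Int_lower1] measure_nonneg[of N' "A \<inter> H"] by linarith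
  finally have "measure P A \<le> measure P' A" .
  moreover have "measure N A = measure N' (A - H) - measure P' (A - H)"
    using split[OF R(2)] z val[OF AH(2)] by simp
  then have "measure N A \<le> measure N' A"
    using meas[OF R(4) AH(2) Diff_subset] measure_nonneg[of P' "A - H"] by linarith
  moreover have "emeasure M A = ennreal (measure M A)" if "radon_measure M" for M
    using fin[OF that, of A] by (simp add: emeasure_eq_ennreal_measure less_top)
  ultimately show "emeasure P A \<le> emeasure P' A" "emeasure N A \<le> emeasure N' A"
    using R by (auto intro: ennreal_leI)
qed

lemma radon_measure_eqI:
  assumes R: "radon_measure M" "radon_measure M'"
    and eq: "\<And>A n. A \<in> sets borel_nonneg \<Longrightarrow> A \<subseteq> {0..real n} \<Longrightarrow> emeasure M A = emeasure M' A"
  shows "M = M'"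
proof (rule measure_eqI)
  show "sets M = sets M'" using R by (simp add: radon_measure_def)
  fix A assume "A \<in> sets M"
  then have A: "A \<in> sets borel_nonneg" "A \<in> sets M" "A \<in> sets M'" "A \<subseteq> {0..}"
    using sets.sets_into_space[of A M]
    by (simp_all add: sets_radon_measure[OF R(1)] sets_radon_measure[OF R(2)]
      space_radon_measure[OF R(1)])
  have K: "emeasure M K = emeasure M' K" if K: "compact K" "K \<subseteq> A" for K
  proof -
    obtain b where "\<forall>x\<in>K. \<bar>x\<bar> \<le> b"
      using compact_imp_bounded[OF K(1)] unfolding bounded_real by blast
    then have b: "x \<le> b" if "x \<in> K" for x using that by fastforce
    obtain n where n: "b \<le> real n" using real_arch_simple by blast
    have "K \<subseteq> {0..real n}"
    proof
      fix x assume "x \<in> K"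
      then show "x \<in> {0..real n}" using b[of x] n K(2) A(4) by auto
    qed
    moreover have "K \<in> sets borel_nonneg"
      using borel_compact[OF K(1)] K(2) A(4) by (simp add: sets_restrict_space_iff)
    ultimately show ?thesis using eq by blast
  qed
  have "emeasure M A = (SUP K\<in>{K. K \<subseteq> A \<and> compact K}. emeasure M K)"
    using R(1) A(2) unfolding radon_measure_def by blast
  also have "\<dots> = (SUP K\<in>{K. K \<subseteq> A \<and> compact K}. emeasure M' K)"
    using K by (intro SUP_cong) auto
  also have "\<dots> = emeasure M' A"
    using R(2) A(3) unfolding radon_measure_def by metis
  finally show "emeasure M A = emeasure M' A" .
qed

lemma jordan_pair_unique:
  assumes "jordan_pair \<mu> P N" "jordan_pair \<mu> P' N'"
  shows "P = P'" "N = N'"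
proof -
  have R: "radon_measure P" "radon_measure P'" "radon_measure N" "radon_measure N'"
    using assms by (auto simp: jordan_pair_def)
  note le = jordan_pair_le[OF assms] jordan_pair_le[OF assms(2,1)]
  show "P = P'" by (rule radon_measure_eqI[OF R(1,2)]) (rule antisym; rule le; assumption)
  show "N = N'" by (rule radon_measure_eqI[OF R(3,4)]) (rule antisym; rule le; assumption)
qed

lemma jordan_decomp_eq:
  assumes "jordan_pair \<mu> P N"
  shows "pos_part \<mu> = P" "neg_part \<mu> = N"
proof -
  have "jordan_decomp \<mu> = (P, N)"
    unfolding jordan_decomp_def
  proof (rule the_equality)
    show "case (P, N) of (P, N) \<Rightarrow> jordan_pair \<mu> P N" using assms by simp
  next
    fix q assume "case q of (P, N) \<Rightarrow> jordan_pair \<mu> P N"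
    then have "jordan_pair \<mu> (fst q) (snd q)" by (simp add: case_prod_beta)
    from jordan_pair_unique[OF this assms] show "q = (P, N)" by (simp add: prod_eq_iff)
  qed
  then show "pos_part \<mu> = P" "neg_part \<mu> = N" by (simp_all add: pos_part_def neg_part_def)
qed

definition abs_measure :: "(real set \<Rightarrow> ereal) \<Rightarrow> real measure" where
  "abs_measure \<mu> = measure_of {0..} (sets borel_nonneg)
     (\<lambda>A. emeasure (pos_part \<mu>) A + emeasure (neg_part \<mu>) A)"

text \<open>The set function in the definition of \<^const>\<open>abs_measure\<close> is indeed a measure, so
  \<^const>\<open>measure_of\<close> does not fall back to the zero measure.\<close>

lemma sets_abs_measure: "sets (abs_measure \<mu>) = sets borel_nonneg"
proof -
  have "space borel_nonneg = {0..}" by (simp add: space_restrict_space)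
  then show ?thesis
    unfolding abs_measure_def using sets.sets_measure_of_eq[of borel_nonneg] by simp
qed

lemma emeasure_abs_measure:
  assumes "gen_signed_radon \<mu>" "A \<in> sets borel_nonneg"
  shows "emeasure (abs_measure \<mu>) A = emeasure (pos_part \<mu>) A + emeasure (neg_part \<mu>) A"
proof -
  obtain P N where J: "jordan_pair \<mu> P N"
    using assms(1) by (auto simp: gen_signed_radon_def)
  have S: "sets P = sets borel_nonneg" "sets N = sets borel_nonneg"
    using J by (simp_all add: jordan_pair_def sets_radon_measure)
  show ?thesis
    unfolding abs_measure_def jordan_decomp_eq[OF J]
  proof (rule emeasure_measure_of_sigma)
    show "sigma_algebra {0..} (sets borel_nonneg)"
      using sets.sigma_algebra_axioms[of borel_nonneg] by (simp add: space_restrict_space)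
    show "positive (sets borel_nonneg) (\<lambda>A. emeasure P A + emeasure N A)"
      by (simp add: positive_def)
    show "countably_additive (sets borel_nonneg) (\<lambda>A. emeasure P A + emeasure N A)"
      using S by (auto intro!: countably_additiveI simp: suminf_add[symmetric] suminf_emeasure)
  qed (rule assms(2))
qed

definition distr_fun :: "(real set \<Rightarrow> ereal) \<Rightarrow> real \<Rightarrow> real" where
  "distr_fun \<mu> x = (if x = 0 then 0 else real_of_ereal (\<mu> {0..x}))"

definition laplace_abs :: "(real set \<Rightarrow> ereal) \<Rightarrow> real \<Rightarrow> ennreal" where
  "laplace_abs \<mu> l = (\<integral>\<^sup>+x. ennreal (exp (- l * x)) \<partial>abs_measure \<mu>)"

definition M_Psi :: "(real set \<Rightarrow> ereal) set" where
  "M_Psi = {\<mu>. gen_signed_radon \<mu> \<and> (\<forall>l>0. laplace_abs \<mu> l < \<infinity>)}"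

definition signed_integral :: "(real set \<Rightarrow> ereal) \<Rightarrow> (real \<Rightarrow> real) \<Rightarrow> real" where
  "signed_integral \<mu> f = (LINT x|pos_part \<mu>. f x) - (LINT x|neg_part \<mu>. f x)"

definition laplace :: "(real set \<Rightarrow> ereal) \<Rightarrow> real \<Rightarrow> real" where
  "laplace \<mu> l = signed_integral \<mu> (\<lambda>x. exp (- l * x))"

definition right_equicontinuous_at :: "(nat \<Rightarrow> real set \<Rightarrow> ereal) \<Rightarrow> real \<Rightarrow> bool" where
  "right_equicontinuous_at \<mu>s x \<longleftrightarrow>
     (\<forall>\<epsilon>>0. \<exists>h>0. \<forall>\<delta>. 0 < \<delta> \<and> \<delta> < h \<longrightarrow>
        limsup (\<lambda>n. \<bar>\<mu>s n {x<..x + \<delta>}\<bar>) \<le> ereal \<epsilon>)"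

definition continuity_point :: "(real set \<Rightarrow> ereal) \<Rightarrow> real \<Rightarrow> bool" where
  "continuity_point \<mu> x \<longleftrightarrow> 0 \<le> x \<and> \<mu> {x} = 0"

end

theory Submission
  imports Defs
begin

text \<open>If \<open>f(y)\<close> is the integral of \<open>k\<close> over \<open>[y, \<infinity>)\<close>, then Tonelli turns
  \<open>\<integral>f d\<mu>\<close> into \<open>\<integral>k(s) \<mu>([0,s]) ds\<close>. With \<open>k(s) = \<lambda> exp(-\<lambda>s)\<close> on \<open>[0, \<infinity>)\<close> this expresses the
  Laplace transform through the distribution function, and part (b) is dominated convergence, the
  dominating function coming from \<open>|\<mu>\<^sub>n|([0,s]) \<le> exp(\<lambda>s/2) \<Psi>\<^bsub>|\<mu>\<^sub>n|\<^esub>(\<lambda>/2)\<close>.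
  For part (a), Weierstrass approximation in the variable \<open>t = exp(-x)\<close> upgrades convergence of the
  Laplace transforms to convergence of the integrals of all compactly supported continuous functions.
  With \<open>k\<close> the uniform density on \<open>[x, x + d]\<close>, the function \<open>f\<close> is a ramp and its integral is the
  average of the distribution function over \<open>[x, x + d]\<close>; right-equicontinuity makes that average
  asymptotically close to the value at \<open>x\<close>.\<close>

section \<open>Radon measures on the half-line and the layer-cake formula\<close>

lemma radon_measure_interval_sets:
  assumes "radon_measure M"
  shows "{0..s} \<in> sets M"
  using assms by (auto simp: sets_radon_measure sets_restrict_space_iff)

lemma radon_measure_interval_finite:
  assumes "radon_measure M"
  shows "emeasure M {0..s} < \<infinity>"
  using radon_measure_finite_on_compact[OF assms, of "{0..s}"] by auto

text \<open>The intervals \<open>{0..real n}\<close> have finite mass and exhaust the half-line;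
  Tonelli relies on this.\<close>

lemma radon_measure_sigma_finite:
  assumes M: "radon_measure M"
  shows "sigma_finite_measure M"
proof
  show "\<exists>A. countable A \<and> A \<subseteq> sets M \<and> \<Union> A = space M \<and> (\<forall>a\<in>A. emeasure M a \<noteq> \<infinity>)"
  proof (intro exI conjI)
    show "\<Union> (range (\<lambda>n. {0..real n})) = space M"
      using real_arch_simple by (auto simp: space_radon_measure[OF M])
  qed (use radon_measure_interval_sets[OF M] radon_measure_interval_finite[OF M] in
      \<open>auto simp: less_top\<close>)
qed

lemma borel_measurable_radon_measure:
  assumes "radon_measure M" "f \<in> borel_measurable borel"
  shows "f \<in> borel_measurable M"
  using measurable_restrict_space1[OF assms(2)]
    measurable_cong_sets[OF sets_radon_measure[OF assms(1)] refl]
  by blast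

text \<open>Tonelli on the region \<open>y \<le> s\<close> with weight \<open>k s\<close>:
  integrating over \<open>s\<close> first gives \<open>f y\<close> by \<open>fk\<close>, integrating
  over \<open>y\<close> first gives \<open>k s * measure M {0..s}\<close>. Nonnegativity permits the
  exchange for extended integrals; integrability of \<open>f\<close> then leads back to real
  ones.\<close>

lemma radon_measure_layer_cake:
  fixes k f :: "real \<Rightarrow> real"
  assumes M: "radon_measure M"
    and k [measurable]: "k \<in> borel_measurable borel" and k0: "\<And>s. 0 \<le> k s"
    and f [measurable]: "f \<in> borel_measurable borel" and f0: "\<And>y. 0 \<le> y \<Longrightarrow> 0 \<le> f y"
    and fk: "\<And>y. 0 \<le> y \<Longrightarrow> (\<integral>\<^sup>+s. ennreal (k s) * indicator {y..} s \<partial>lborel) = ennreal (f y)"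
    and int: "integrable M f"
  shows "integrable lborel (\<lambda>s. k s * measure M {0..s})"
    and "(LINT y|M. f y) = (LINT s|lborel. k s * measure M {0..s})"
proof -
  interpret M: sigma_finite_measure M by (rule radon_measure_sigma_finite[OF M])
  interpret pair_sigma_finite M lborel ..
  have id [measurable]: "(\<lambda>x. x) \<in> borel_measurable M" "f \<in> borel_measurable M"
    by (rule borel_measurable_radon_measure[OF M], measurable)+
  note sp = space_radon_measure[OF M]
  have "(\<integral>\<^sup>+y. ennreal (f y) \<partial>M) =
      (\<integral>\<^sup>+y. (\<integral>\<^sup>+s. (if y \<le> s then ennreal (k s) else 0) \<partial>lborel) \<partial>M)"
    using fk by (intro nn_integral_cong)
      (auto simp: sp intro!: nn_integral_cong simp flip: fk split: split_indicator)
  also have "\<dots> = (\<integral>\<^sup>+s. (\<integral>\<^sup>+y. (if y \<le> s then ennreal (k s) else 0) \<partial>M) \<partial>lborel)"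
    by (rule Fubini'[symmetric]) measurable
  also have "\<dots> = (\<integral>\<^sup>+s. (\<integral>\<^sup>+y. ennreal (k s) * indicator {0..s} y \<partial>M) \<partial>lborel)"
    by (intro nn_integral_cong) (auto simp: sp split: split_indicator)
  also have "\<dots> = (\<integral>\<^sup>+s. ennreal (k s) * emeasure M {0..s} \<partial>lborel)"
    by (intro nn_integral_cong nn_integral_cmult_indicator radon_measure_interval_sets M)
  also have "\<dots> = (\<integral>\<^sup>+s. ennreal (k s * measure M {0..s}) \<partial>lborel)"
    using radon_measure_interval_finite[OF M] k0
    by (intro nn_integral_cong) (simp add: ennreal_mult emeasure_eq_ennreal_measure less_top)
  finally have eq: "(\<integral>\<^sup>+y. ennreal (f y) \<partial>M) = (\<integral>\<^sup>+s. ennreal (k s * measure M {0..s}) \<partial>lborel)" .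
  \<comment> \<open>Monotonicity is what makes \<open>s \<mapsto> measure M {0..s}\<close> Borel
    measurable.\<close>
  have mono: "mono (\<lambda>s. measure M {0..s})"
    using radon_measure_interval_finite[OF M] radon_measure_interval_sets[OF M]
    by (intro monoI measure_mono_fmeasurable) (auto simp: fmeasurable_def)
  have [measurable]: "(\<lambda>s. measure M {0..s}) \<in> borel_measurable borel"
    by (rule borel_measurable_mono[OF mono])
  have ae: "AE y in M. 0 \<le> f y" using f0 by (intro AE_I2) (simp add: sp)
  have fin: "(\<integral>\<^sup>+y. ennreal (f y) \<partial>M) < \<infinity>"
    using int ae nn_integral_eq_integral[OF int ae] by simp
  show int2: "integrable lborel (\<lambda>s. k s * measure M {0..s})"
    using fin eq k0 by (intro integrableI_nonneg) auto
  show "(LINT y|M. f y) = (LINT s|lborel. k s * measure M {0..s})"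
    using eq ae k0 by (simp add: integral_eq_nn_integral)
qed

text \<open>The ramp is the tail function of the uniform law on \<open>{x..x + d}\<close>: it equals
  1 up to \<open>x\<close> and falls linearly to 0 at \<open>x + d\<close>.\<close>

lemma ramp_layer:
  fixes x d y :: real
  assumes "0 < d"
  shows "(\<integral>\<^sup>+s. ennreal (indicator {x..x + d} s / d) * indicator {y..} s \<partial>lborel)
    = ennreal (min 1 (max 0 ((x + d - y) / d)))"
proof -
  have "(\<integral>\<^sup>+s. ennreal (indicator {x..x + d} s / d) * indicator {y..} s \<partial>lborel)
      = (\<integral>\<^sup>+s. ennreal (1 / d) * indicator {max x y..x + d} s \<partial>lborel)"
    by (intro nn_integral_cong) (auto split: split_indicator)
  \<comment> \<open>The remaining interval is empty when \<open>y > x + d\<close>, hence the cut-off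
    of its length at 0.\<close>
  also have "\<dots> = ennreal (1 / d) * ennreal (max 0 (x + d - max x y))"
    by (subst nn_integral_cmult_indicator) (auto simp: emeasure_lborel_Icc_eq max_def)
  also have "\<dots> = ennreal (min 1 (max 0 ((x + d - y) / d)))"
    using assms by (subst ennreal_mult[symmetric]) (auto simp: field_simps max_def min_def)
  finally show ?thesis .
qed

text \<open>The tail function of the exponential law with rate \<open>l\<close>, computed from the
  antiderivative \<open>- exp (- l * s)\<close>, which vanishes at infinity.\<close>

lemma exp_layer:
  fixes l y :: real
  assumes "0 < l" "0 \<le> y"
  shows "(\<integral>\<^sup>+s. ennreal (l * exp (- l * s) * indicator {0..} s) * indicator {y..} s \<partial>lborel)
    = ennreal (exp (- l * y))"
proof -
  have "(\<integral>\<^sup>+s. ennreal (l * exp (- l * s) * indicator {0..} s) * indicator {y..} s \<partial>lborel)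
      = (\<integral>\<^sup>+s. ennreal (l * exp (- l * s)) * indicator {y..} s \<partial>lborel)"
    using assms by (intro nn_integral_cong) (auto split: split_indicator)
  also have "\<dots> = ennreal (0 - (- exp (- l * y)))"
  proof (rule nn_integral_FTC_atLeast)
    have "filterlim (\<lambda>x. l * x) at_top at_top"
      using assms filterlim_tendsto_pos_mult_at_top[OF tendsto_const _ filterlim_ident] by blast
    then have "filterlim (\<lambda>x. - l * x) at_bot at_top"
      by (simp add: filterlim_uminus_at_top)
    then have "((\<lambda>x. exp (- l * x)) \<longlongrightarrow> 0) at_top"
      by (rule filterlim_compose[OF exp_at_bot])
    then show "((\<lambda>x. - exp (- l * x)) \<longlongrightarrow> 0) at_top"
      using tendsto_minus by fastforce
  qed (use assms in \<open>auto intro!: derivative_eq_intros\<close>)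
  finally show ?thesis by simp
qed

section \<open>Bounds for the Jordan parts and the cumulative function\<close>

text \<open>Each part is dominated by \<open>abs_measure \<mu>\<close> set by set. The disjunction
  on \<open>M\<close> lets one statement serve both parts, here and below.\<close>

lemma nn_integral_abs_measure_ge:
  assumes "gen_signed_radon \<mu>" and "M = pos_part \<mu> \<or> M = neg_part \<mu>"
  shows "radon_measure M" "(\<integral>\<^sup>+x. f x \<partial>M) \<le> (\<integral>\<^sup>+x. f x \<partial>abs_measure \<mu>)"
proof -
  obtain P N where J: "jordan_pair \<mu> P N"
    using assms(1) by (auto simp: gen_signed_radon_def)
  note D = jordan_decomp_eq[OF J]
  show R: "radon_measure M" using J assms(2) D by (auto simp: jordan_pair_def)
  have S: "sets M = sets (abs_measure \<mu>)"
    by (simp add: sets_radon_measure[OF R] sets_abs_measure)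
  have "emeasure M A \<le> emeasure (abs_measure \<mu>) A" for A
  proof (cases "A \<in> sets borel_nonneg")
    case True
    then show ?thesis using assms by (auto simp: emeasure_abs_measure)
  next
    \<comment> \<open>Measures are compared on all sets; outside the sigma-algebra
      \<open>emeasure\<close> is 0 by default.\<close>
    case False
    then show ?thesis using sets_radon_measure[OF R] by (simp add: emeasure_notin_sets)
  qed
  then have "M \<le> abs_measure \<mu>"
    using S sets_eq_imp_space_eq[OF S] by (simp add: le_measure_iff le_fun_def)
  then show "(\<integral>\<^sup>+x. f x \<partial>M) \<le> (\<integral>\<^sup>+x. f x \<partial>abs_measure \<mu>)"
    using nn_integral_mono_measure[OF S] by blast
qed

text \<open>Real-valued for use in estimates. \<open>enn2real\<close> would turn \<infinity> into 0,
  but on \<open>M_Psi\<close> the value at \<open>l > 0\<close> is finite.\<close>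

definition total_laplace :: "(real set \<Rightarrow> ereal) \<Rightarrow> real \<Rightarrow> real" where
  "total_laplace \<mu> l = enn2real (laplace_abs \<mu> l)"

text \<open>In contrast to \<^const>\<open>distr_fun\<close>, this keeps an atom at 0.\<close>

definition cumul :: "(real set \<Rightarrow> ereal) \<Rightarrow> real \<Rightarrow> real" where
  "cumul \<mu> x = measure (pos_part \<mu>) {0..x} - measure (neg_part \<mu>) {0..x}"

lemma M_Psi_part:
  assumes "\<mu> \<in> M_Psi" and "M = pos_part \<mu> \<or> M = neg_part \<mu>"
  shows M_Psi_part_radon: "radon_measure M"
    and M_Psi_part_integrable: "0 < l \<Longrightarrow> integrable M (\<lambda>x. exp (- l * x))"
    and M_Psi_part_le: "0 < l \<Longrightarrow> (LINT x|M. exp (- l * x)) \<le> total_laplace \<mu> l"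
proof -
  have g: "gen_signed_radon \<mu>" using assms by (simp add: M_Psi_def)
  note M = nn_integral_abs_measure_ge[OF g assms(2)]
  show R: "radon_measure M" by (rule M(1))
  have [measurable]: "(\<lambda>x. x) \<in> borel_measurable M"
    by (rule borel_measurable_radon_measure[OF R]) measurable
  assume "0 < l"
  then have fin: "laplace_abs \<mu> l < \<infinity>" using assms by (simp add: M_Psi_def)
  have le: "(\<integral>\<^sup>+x. ennreal (exp (- l * x)) \<partial>M) \<le> laplace_abs \<mu> l"
    unfolding laplace_abs_def by (rule M(2))
  show "integrable M (\<lambda>x. exp (- l * x))"
    using le fin by (intro integrableI_nonneg) auto
  show "(LINT x|M. exp (- l * x)) \<le> total_laplace \<mu> l"
    unfolding total_laplace_def using le fin by (simp add: integral_eq_nn_integral enn2real_mono)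
qed

text \<open>A Chernoff-type bound: the indicator of \<open>{0..s}\<close> is at most
  \<open>exp (l * (s - x))\<close> at every \<open>x\<close>.\<close>

lemma M_Psi_part_interval_le:
  assumes "\<mu> \<in> M_Psi" and "M = pos_part \<mu> \<or> M = neg_part \<mu>" and "0 < l"
  shows "measure M {0..s} \<le> exp (l * s) * total_laplace \<mu> l"
proof -
  note R = M_Psi_part_radon[OF assms(1,2)]
  note fin = radon_measure_interval_finite[OF R, of s]
  have "measure M {0..s} = (LINT x|M. indicator {0..s} x)"
    using sets.sets_into_space[OF radon_measure_interval_sets[OF R, of s]] by (simp add: Int_absorb2)
  also have "\<dots> \<le> (LINT x|M. exp (l * s) * exp (- l * x))"
  proof (rule integral_mono)
    show "integrable M (indicat_real {0..s})"
      using fin radon_measure_interval_sets[OF R] by simp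
    show "integrable M (\<lambda>x. exp (l * s) * exp (- l * x))"
      by (intro integrable_mult_right M_Psi_part_integrable[OF assms])
    show "indicator {0..s} x \<le> exp (l * s) * exp (- l * x)" for x
      using assms(3) by (auto split: split_indicator simp flip: exp_add)
  qed
  also have "\<dots> \<le> exp (l * s) * total_laplace \<mu> l"
    using M_Psi_part_le[OF assms] by simp
  finally show ?thesis .
qed

text \<open>Radon measures are finite on bounded Borel sets, so the infinite branch of
  \<open>jordan_pair\<close> does not occur.\<close>

lemma M_Psi_value:
  assumes "\<mu> \<in> M_Psi" "A \<in> sets borel_nonneg" "A \<subseteq> {0..s}"
  shows "\<mu> A = ereal (measure (pos_part \<mu>) A - measure (neg_part \<mu>) A)"
proof -
  obtain P N where J: "jordan_pair \<mu> P N"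
    using assms(1) by (auto simp: M_Psi_def gen_signed_radon_def)
  have fin: "emeasure M A < \<infinity>" if "radon_measure M" for M
    using emeasure_mono[OF assms(3) radon_measure_interval_sets[OF that]]
      radon_measure_interval_finite[OF that]
    by (rule le_less_trans)
  then show ?thesis
    using J assms(2) unfolding jordan_decomp_eq[OF J] by (auto simp: jordan_pair_def)
qed

lemma radon_measure_Ioc:
  assumes R: "radon_measure M" and "0 \<le> x" "x \<le> s"
  shows "measure M {x<..s} = measure M {0..s} - measure M {0..x}"
proof -
  have "{x<..s} = {0..s} - {0..x}" using assms by auto
  then show ?thesis
    using assms radon_measure_interval_finite[OF R] radon_measure_interval_sets[OF R]
    by (subst measure_Diff[symmetric]) (auto simp: less_top)
qed

text \<open>This turns right-equicontinuity into a statement about increments of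
  \<open>cumul\<close>.\<close>

lemma M_Psi_Ioc:
  assumes "\<mu> \<in> M_Psi" "0 \<le> x" "x \<le> s"
  shows "\<mu> {x<..s} = ereal (cumul \<mu> s - cumul \<mu> x)"
proof -
  have "{x<..s} \<in> sets borel_nonneg" "{x<..s} \<subseteq> {0..s}"
    using assms by (auto simp: sets_restrict_space_iff)
  from M_Psi_value[OF assms(1) this] show ?thesis
    using assms by (simp add: cumul_def radon_measure_Ioc M_Psi_part_radon)
qed

lemma distr_fun_eq_cumul:
  assumes "\<mu> \<in> M_Psi" "x \<noteq> 0"
  shows "distr_fun \<mu> x = cumul \<mu> x"
proof -
  have "{0..x} \<in> sets borel_nonneg" by (auto simp: sets_restrict_space_iff)
  from M_Psi_value[OF assms(1) this order_refl] show ?thesis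
    using assms by (simp add: distr_fun_def cumul_def)
qed

text \<open>Both parts lie between 0 and the same bound, so their difference obeys it without a
  factor 2.\<close>

lemma cumul_le:
  assumes "\<mu> \<in> M_Psi" "0 < l"
  shows "\<bar>cumul \<mu> s\<bar> \<le> exp (l * s) * total_laplace \<mu> l"
  using M_Psi_part_interval_le[OF assms(1) disjI1[OF refl] assms(2), of s]
    M_Psi_part_interval_le[OF assms(1) disjI2[OF refl] assms(2), of s]
    measure_nonneg[of "pos_part \<mu>" "{0..s}"] measure_nonneg[of "neg_part \<mu>" "{0..s}"]
  unfolding cumul_def by linarith

lemma signed_integral_layer_cake:
  fixes k f :: "real \<Rightarrow> real"
  assumes \<mu>: "\<mu> \<in> M_Psi"
    and k: "k \<in> borel_measurable borel" "\<And>s. 0 \<le> k s"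
    and f: "f \<in> borel_measurable borel" "\<And>y. 0 \<le> y \<Longrightarrow> 0 \<le> f y"
    and fk: "\<And>y. 0 \<le> y \<Longrightarrow> (\<integral>\<^sup>+s. ennreal (k s) * indicator {y..} s \<partial>lborel) = ennreal (f y)"
    and int: "integrable (pos_part \<mu>) f" "integrable (neg_part \<mu>) f"
  shows "integrable lborel (\<lambda>s. k s * cumul \<mu> s)"
    and "signed_integral \<mu> f = (LINT s|lborel. k s * cumul \<mu> s)"
proof -
  note P = radon_measure_layer_cake[OF M_Psi_part_radon[OF \<mu> disjI1[OF refl]] k f fk int(1)]
  note N = radon_measure_layer_cake[OF M_Psi_part_radon[OF \<mu> disjI2[OF refl]] k f fk int(2)]
  show "integrable lborel (\<lambda>s. k s * cumul \<mu> s)"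
    using Bochner_Integration.integrable_diff[OF P(1) N(1)] by (simp add: cumul_def algebra_simps)
  show "signed_integral \<mu> f = (LINT s|lborel. k s * cumul \<mu> s)"
    using Bochner_Integration.integral_diff[OF P(1) N(1)] P(2) N(2)
    by (simp add: cumul_def signed_integral_def algebra_simps)
qed

lemma laplace_eq_integral_cumul:
  assumes \<mu>: "\<mu> \<in> M_Psi" and l: "0 < l"
  shows "integrable lborel (\<lambda>s. l * exp (- l * s) * indicator {0..} s * cumul \<mu> s)"
    and "laplace \<mu> l = (LINT s|lborel. l * exp (- l * s) * indicator {0..} s * cumul \<mu> s)"
  unfolding laplace_def using l
  by (intro signed_integral_layer_cake[OF \<mu> _ _ _ _ exp_layer[OF l]]
      M_Psi_part_integrable[OF \<mu> _ l]; auto)+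

text \<open>The exponential density has total mass 1, by \<open>exp_layer\<close> at 0; an infinite
  integral would stay infinite after multiplication by \<open>l > 0\<close>.\<close>

lemma integrable_exp_halfline:
  assumes "0 < (l :: real)"
  shows "integrable lborel (\<lambda>s. exp (- l * s) * indicator {0..} s)"
proof (rule integrableI_nonneg)
  have "(\<integral>\<^sup>+s. ennreal (l * exp (- l * s) * indicator {0..} s) * indicator {0..} s \<partial>lborel) = 1"
    using exp_layer[OF assms, of 0] by simp
  also have "(\<integral>\<^sup>+s. ennreal (l * exp (- l * s) * indicator {0..} s) * indicator {0..} s \<partial>lborel)
      = (\<integral>\<^sup>+s. ennreal l * ennreal (exp (- l * s) * indicator {0..} s) \<partial>lborel)"
    using assms by (intro nn_integral_cong) (auto split: split_indicator simp: ennreal_mult)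
  also have "\<dots> = ennreal l * (\<integral>\<^sup>+s. ennreal (exp (- l * s) * indicator {0..} s) \<partial>lborel)"
    by (rule nn_integral_cmult) measurable
  finally show "(\<integral>\<^sup>+s. ennreal (exp (- l * s) * indicator {0..} s) \<partial>lborel) < \<infinity>"
    using assms
    by (cases "(\<integral>\<^sup>+s. ennreal (exp (- l * s) * indicator {0..} s) \<partial>lborel) = \<infinity>")
      (auto simp: less_top ennreal_mult_top)
qed auto

section \<open>Part (b): from distribution functions to Laplace transforms\<close>

lemma laplace_tendsto_of_distr_fun:
  assumes \<mu>s: "\<And>n. \<mu>s n \<in> M_Psi" and \<mu>: "\<mu> \<in> M_Psi"
    and bd: "\<And>l. 0 < l \<Longrightarrow> \<exists>C. \<forall>n. total_laplace (\<mu>s n) l \<le> C"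
    and lim: "AE x\<in>{0..} in lborel. (\<lambda>n. distr_fun (\<mu>s n) x) \<longlonglongrightarrow> distr_fun \<mu> x"
    and l: "0 < l"
  shows "(\<lambda>n. laplace (\<mu>s n) l) \<longlonglongrightarrow> laplace \<mu> l"
proof -
  \<comment> \<open>Half of the decay of \<open>exp (- l * s)\<close> absorbs the growth of
    \<open>cumul\<close>, bounded at rate \<open>l / 2\<close>; the other half is the integrable
    majorant.\<close>
  have l2: "0 < l / 2" using l by simp
  obtain C where C: "\<And>n. total_laplace (\<mu>s n) (l / 2) \<le> C" using bd[OF l2] by auto
  show ?thesis
    unfolding laplace_eq_integral_cumul(2)[OF \<mu>s l] laplace_eq_integral_cumul(2)[OF \<mu> l]
  proof (rule integral_dominated_convergence)
    show "integrable lborel (\<lambda>s. l * C * (exp (- (l / 2) * s) * indicator {0..} s))"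
      by (intro integrable_mult_right integrable_exp_halfline l2)
    show "AE s in lborel. (\<lambda>n. l * exp (- l * s) * indicator {0..} s * cumul (\<mu>s n) s)
        \<longlonglongrightarrow> l * exp (- l * s) * indicator {0..} s * cumul \<mu> s"
      \<comment> \<open>At 0 the functions \<open>distr_fun\<close> and \<open>cumul\<close> may
        differ by an atom, so this null set is left out.\<close>
      using lim AE_lborel_singleton[of 0]
    proof eventually_elim
      case (elim s)
      then show ?case
        using \<mu>s \<mu> by (auto simp: distr_fun_eq_cumul split: split_indicator intro!: tendsto_mult_left)
    qed
    show "AE s in lborel. norm (l * exp (- l * s) * indicator {0..} s * cumul (\<mu>s n) s)
        \<le> l * C * (exp (- (l / 2) * s) * indicator {0..} s)" for n
    proof (rule AE_I2)
      fix s :: real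
      have "\<bar>cumul (\<mu>s n) s\<bar> \<le> exp (l / 2 * s) * C"
        using cumul_le[OF \<mu>s l2, of n s] C[of n]
        by (meson exp_ge_zero mult_left_mono order_trans)
      then have "l * exp (- l * s) * \<bar>cumul (\<mu>s n) s\<bar> \<le> l * exp (- l * s) * (exp (l / 2 * s) * C)"
        using l by (intro mult_left_mono) auto
      also have "\<dots> = l * C * exp (- (l / 2) * s)"
        by (simp add: field_simps flip: exp_add)
      finally show "norm (l * exp (- l * s) * indicator {0..} s * cumul (\<mu>s n) s)
        \<le> l * C * (exp (- (l / 2) * s) * indicator {0..} s)"
        using l by (auto simp: abs_mult split: split_indicator)
    qed
  qed (use laplace_eq_integral_cumul(1)[OF \<mu>s l] laplace_eq_integral_cumul(1)[OF \<mu> l] in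
      \<open>auto dest: borel_measurable_integrable\<close>)
qed

section \<open>Weierstrass approximation and convergence of integrals of continuous
  functions\<close>

text \<open>The measures may have infinite mass, so the error must carry the weight
  \<open>exp (- y)\<close>. Hence \<open>g y / exp (- y)\<close> is approximated by a polynomial in
  \<open>exp (- y)\<close> and multiplied back; the exponents then start at 1, where Laplace
  transforms exist.\<close>

lemma exp_polynomial_approx:
  fixes g :: "real \<Rightarrow> real"
  assumes g: "continuous_on UNIV g" "\<And>y. b \<le> y \<Longrightarrow> g y = 0" and e: "0 < e"
  obtains a and n :: nat where
    "\<And>y. 0 \<le> y \<Longrightarrow> \<bar>g y - (\<Sum>i\<le>n. a i * exp (- real (Suc i) * y))\<bar> \<le> e * exp (- y)"
proof -
  \<comment> \<open>\<open>\<phi> t = g (- ln t) / t\<close> on \<open>(0, 1]\<close>; the cut-off, invisible because \<open>g\<close> vanishes on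
    \<open>[b, \<infinity>)\<close>, extends it continuously to \<open>t = 0\<close>.\<close>
  define \<phi> where "\<phi> t = g (- ln (max t (exp (- b)))) / max t (exp (- b))" for t :: real
  have pos: "0 < max t (exp (- b))" for t :: real by (simp add: less_max_iff_disj)
  have "continuous_on {0..1} \<phi>"
    unfolding \<phi>_def using pos
    by (intro continuous_intros continuous_on_compose2[OF g(1)]) (auto simp: less_imp_neq[symmetric])
  then obtain p where p: "real_polynomial_function p" "\<And>t. t \<in> {0..1} \<Longrightarrow> \<bar>\<phi> t - p t\<bar> < e"
    using Stone_Weierstrass_real_polynomial_function[OF compact_Icc _ e] by metis
  obtain a and n :: nat where a: "p = (\<lambda>t. \<Sum>i\<le>n. a i * t ^ i)"
    using p(1) by (auto simp: real_polynomial_function_iff_sum)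
  show thesis
  proof
    fix y :: real assume "0 \<le> y"
    then have "\<bar>\<phi> (exp (- y)) - p (exp (- y))\<bar> \<le> e" using p(2)[of "exp (- y)"] by simp
    then have "\<bar>\<phi> (exp (- y)) - p (exp (- y))\<bar> * exp (- y) \<le> e * exp (- y)" by simp
    also have "\<bar>\<phi> (exp (- y)) - p (exp (- y))\<bar> * exp (- y) =
        \<bar>\<phi> (exp (- y)) * exp (- y) - p (exp (- y)) * exp (- y)\<bar>"
      by (simp add: abs_mult flip: left_diff_distrib)
    \<comment> \<open>For \<open>y \<le> b\<close> the cut-off is inactive; beyond \<open>b\<close>
      both sides vanish, since \<open>g b = 0\<close> and \<open>g y = 0\<close>.\<close>
    also have "\<phi> (exp (- y)) * exp (- y) = g y"
      using g(2)[of b] g(2)[of y] by (auto simp: \<phi>_def max_def)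
    also have "p (exp (- y)) * exp (- y) = (\<Sum>i\<le>n. a i * exp (- real (Suc i) * y))"
      unfolding a sum_distrib_right
      by (intro sum.cong) (auto simp: exp_of_nat_mult[symmetric] algebra_simps simp flip: exp_add)
    finally show "\<bar>g y - (\<Sum>i\<le>n. a i * exp (- real (Suc i) * y))\<bar> \<le> e * exp (- y)" .
  qed
qed

text \<open>The weight makes the error integrable, with integral controlled by the Laplace transform
  at 1. Integrability of \<open>g\<close> follows by writing it as \<open>h\<close> plus the
  error.\<close>

lemma M_Psi_part_close:
  assumes \<mu>: "\<mu> \<in> M_Psi" "M = pos_part \<mu> \<or> M = neg_part \<mu>"
    and g: "g \<in> borel_measurable borel" and h: "integrable M h"
    and le: "\<And>y. 0 \<le> y \<Longrightarrow> \<bar>g y - h y\<bar> \<le> e * exp (- y)" and e: "0 \<le> e"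
  shows "integrable M g"
    and "\<bar>(LINT y|M. g y) - (LINT y|M. h y)\<bar> \<le> e * total_laplace \<mu> 1"
proof -
  note R = M_Psi_part_radon[OF \<mu>]
  have E: "integrable M (\<lambda>y. e * exp (- y))"
    using M_Psi_part_integrable[OF \<mu>, of 1] by simp
  have [measurable]: "g \<in> borel_measurable M" "h \<in> borel_measurable M"
    using borel_measurable_radon_measure[OF R g] h by auto
  have d: "integrable M (\<lambda>y. g y - h y)"
    using le by (intro Bochner_Integration.integrable_bound[OF E] AE_I2)
      (auto simp: space_radon_measure[OF R] intro: order_trans[OF _ abs_ge_self])
  from Bochner_Integration.integrable_add[OF d h] show gi: "integrable M g" by simp
  have "\<bar>(LINT y|M. g y) - (LINT y|M. h y)\<bar> = \<bar>LINT y|M. g y - h y\<bar>"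
    using gi h by simp
  also have "\<dots> \<le> (LINT y|M. e * exp (- y))"
    using le by (intro integral_abs_bound[THEN order_trans] integral_mono E integrable_abs d)
      (auto simp: space_radon_measure[OF R])
  also have "\<dots> \<le> e * total_laplace \<mu> 1"
    using M_Psi_part_le[OF \<mu>, of 1] e by (auto intro: mult_left_mono)
  finally show "\<bar>(LINT y|M. g y) - (LINT y|M. h y)\<bar> \<le> e * total_laplace \<mu> 1" .
qed

lemma M_Psi_part_exp_sum:
  assumes \<mu>: "\<mu> \<in> M_Psi" "M = pos_part \<mu> \<or> M = neg_part \<mu>"
  shows "integrable M (\<lambda>y. \<Sum>i\<le>n. a i * exp (- real (Suc i) * y))"
    and "(LINT y|M. (\<Sum>i\<le>n. a i * exp (- real (Suc i) * y))) =
      (\<Sum>i\<le>n. a i * (LINT y|M. exp (- real (Suc i) * y)))"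
proof -
  have i: "integrable M (\<lambda>y. a i * exp (- real (Suc i) * y))" for i
    by (intro integrable_mult_right M_Psi_part_integrable[OF \<mu>]) simp
  show "integrable M (\<lambda>y. \<Sum>i\<le>n. a i * exp (- real (Suc i) * y))"
    by (intro Bochner_Integration.integrable_sum i)
  show "(LINT y|M. (\<Sum>i\<le>n. a i * exp (- real (Suc i) * y))) =
      (\<Sum>i\<le>n. a i * (LINT y|M. exp (- real (Suc i) * y)))"
    by (subst Bochner_Integration.integral_sum[OF i]) simp
qed

text \<open>Accuracy 1 suffices here: \<open>g\<close> is within \<open>exp (- y)\<close> of an
  integrable exponential sum.\<close>

lemma M_Psi_part_integrable_compact_support:
  fixes g :: "real \<Rightarrow> real"
  assumes \<mu>: "\<mu> \<in> M_Psi" "M = pos_part \<mu> \<or> M = neg_part \<mu>"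
    and g: "continuous_on UNIV g" "\<And>y. b \<le> y \<Longrightarrow> g y = 0"
  shows "integrable M g"
proof -
  obtain a and n :: nat where
    "\<And>y. 0 \<le> y \<Longrightarrow> \<bar>g y - (\<Sum>i\<le>n. a i * exp (- real (Suc i) * y))\<bar> \<le> 1 * exp (- y)"
    using exp_polynomial_approx[OF g zero_less_one] by blast
  from M_Psi_part_close(1)[OF \<mu> borel_measurable_continuous_onI[OF g(1)] M_Psi_part_exp_sum(1)[OF \<mu>] this]
  show ?thesis by simp
qed

lemma signed_integral_exp_sum:
  assumes "\<mu> \<in> M_Psi"
  shows "signed_integral \<mu> (\<lambda>y. \<Sum>i\<le>n. a i * exp (- real (Suc i) * y)) =
    (\<Sum>i\<le>n. a i * laplace \<mu> (real (Suc i)))"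
  unfolding signed_integral_def laplace_def
    M_Psi_part_exp_sum(2)[OF assms disjI1[OF refl]] M_Psi_part_exp_sum(2)[OF assms disjI2[OF refl]]
  by (simp add: sum_subtractf right_diff_distrib)

text \<open>The factor 2 counts one error for each Jordan part.\<close>

lemma signed_integral_exp_sum_close:
  assumes \<mu>: "\<mu> \<in> M_Psi" and g: "g \<in> borel_measurable borel" and e: "0 \<le> e"
    and le: "\<And>y. 0 \<le> y \<Longrightarrow> \<bar>g y - (\<Sum>i\<le>n. a i * exp (- real (Suc i) * y))\<bar> \<le> e * exp (- y)"
  shows "\<bar>signed_integral \<mu> g - (\<Sum>i\<le>n. a i * laplace \<mu> (real (Suc i)))\<bar>
    \<le> 2 * e * total_laplace \<mu> 1"
  using M_Psi_part_close(2)[OF \<mu> disjI1[OF refl] g M_Psi_part_exp_sum(1)[OF \<mu> disjI1[OF refl]] le e]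
    M_Psi_part_close(2)[OF \<mu> disjI2[OF refl] g M_Psi_part_exp_sum(1)[OF \<mu> disjI2[OF refl]] le e]
  unfolding signed_integral_exp_sum[OF \<mu>, symmetric] signed_integral_def by linarith

text \<open>The approximant integrates to a finite combination of Laplace transforms, which
  converges; the cost of replacing \<open>g\<close> by it is small uniformly in \<open>n\<close>,
  thanks to the bound at 1.\<close>

lemma signed_integral_tendsto_compact_support:
  fixes g :: "real \<Rightarrow> real"
  assumes \<mu>s: "\<And>n. \<mu>s n \<in> M_Psi" and \<mu>: "\<mu> \<in> M_Psi"
    and bd: "\<And>n. total_laplace (\<mu>s n) 1 \<le> C"
    and lim: "\<And>l. 0 < l \<Longrightarrow> (\<lambda>n. laplace (\<mu>s n) l) \<longlonglongrightarrow> laplace \<mu> l"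
    and g: "continuous_on UNIV g" "\<And>y. b \<le> y \<Longrightarrow> g y = 0"
  shows "(\<lambda>n. signed_integral (\<mu>s n) g) \<longlonglongrightarrow> signed_integral \<mu> g"
proof (rule LIMSEQ_I)
  fix r :: real assume r: "0 < r"
  define D where "D = max C (total_laplace \<mu> 1)"
  have D: "0 \<le> D" "\<And>n. total_laplace (\<mu>s n) 1 \<le> D" "total_laplace \<mu> 1 \<le> D"
    using bd by (auto simp: D_def total_laplace_def le_max_iff_disj)
  \<comment> \<open>This gives \<open>2 * e * D = (r / 3) * (D / (D + 1)) < r / 3\<close>; the added
    1 covers \<open>D = 0\<close>.\<close>
  define e where "e = r / (6 * (D + 1))"
  have e: "0 < e" using r D(1) by (simp add: e_def)
  have eD: "2 * e * D < r / 3"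
    using r D(1) by (simp add: e_def field_simps)
  obtain a and k :: nat where
    a: "\<And>y. 0 \<le> y \<Longrightarrow> \<bar>g y - (\<Sum>i\<le>k. a i * exp (- real (Suc i) * y))\<bar> \<le> e * exp (- y)"
    using exp_polynomial_approx[OF g e] by blast
  define S where "S \<nu> = (\<Sum>i\<le>k. a i * laplace \<nu> (real (Suc i)))" for \<nu>
  have close: "\<bar>signed_integral \<nu> g - S \<nu>\<bar> < r / 3" if "\<nu> \<in> M_Psi" "total_laplace \<nu> 1 \<le> D" for \<nu>
  proof -
    have "\<bar>signed_integral \<nu> g - S \<nu>\<bar> \<le> 2 * e * total_laplace \<nu> 1"
      unfolding S_def using e
      by (intro signed_integral_exp_sum_close that a borel_measurable_continuous_onI g) auto
    also have "\<dots> \<le> 2 * e * D" using that e by (intro mult_left_mono) auto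
    finally show ?thesis using eD by linarith
  qed
  have "(\<lambda>n. S (\<mu>s n)) \<longlonglongrightarrow> S \<mu>"
    unfolding S_def by (intro tendsto_intros lim) simp
  from LIMSEQ_D[OF this, of "r / 3"] obtain N where "\<And>n. N \<le> n \<Longrightarrow> norm (S (\<mu>s n) - S \<mu>) < r / 3"
    using r by auto
  then have "norm (signed_integral (\<mu>s n) g - signed_integral \<mu> g) < r" if "N \<le> n" for n
    using close[OF \<mu>s D(2), of n] close[OF \<mu> D(3)] that by (fastforce simp: abs_if split: if_splits)
  then show "\<exists>N. \<forall>n\<ge>N. norm (signed_integral (\<mu>s n) g - signed_integral \<mu> g) < r" by blast
qed

section \<open>Part (a): averages over short intervals and right-equicontinuity\<close>

text \<open>Unlike the indicator of \<open>{0..x}\<close>, the ramp is continuous, so the preceding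
  convergence applies to it; its integral is the mean of \<open>cumul\<close> over
  \<open>{x..x + d}\<close>.\<close>

lemma ramp_integral:
  assumes \<mu>: "\<mu> \<in> M_Psi" and d: "0 < d"
  shows "integrable lborel (\<lambda>s. indicator {x..x + d} s / d * cumul \<mu> s)"
    and "signed_integral \<mu> (\<lambda>y. min 1 (max 0 ((x + d - y) / d))) =
      (LINT s|lborel. indicator {x..x + d} s / d * cumul \<mu> s)"
proof -
  have c: "continuous_on UNIV (\<lambda>y. min 1 (max 0 ((x + d - y) / d)))"
    using d by (intro continuous_intros) auto
  have z: "min 1 (max 0 ((x + d - y) / d)) = 0" if "x + d \<le> y" for y
    using that d divide_nonpos_pos[of "x + d - y" d] by simp
  have i: "integrable M (\<lambda>y. min 1 (max 0 ((x + d - y) / d)))"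
    if "M = pos_part \<mu> \<or> M = neg_part \<mu>" for M
    using M_Psi_part_integrable_compact_support[OF \<mu> that c z] .
  note * = signed_integral_layer_cake[OF \<mu> _ _ _ _ ramp_layer[OF d] i i]
  show "integrable lborel (\<lambda>s. indicator {x..x + d} s / d * cumul \<mu> s)"
    using d by (intro *) auto
  show "signed_integral \<mu> (\<lambda>y. min 1 (max 0 ((x + d - y) / d))) =
      (LINT s|lborel. indicator {x..x + d} s / d * cumul \<mu> s)"
    using d by (intro *) auto
qed

text \<open>The deviation of \<open>cumul\<close> from its value at \<open>x\<close> is at most
  \<open>e\<close> plus its excess over \<open>e\<close>. Averaging against a density of mass 1
  leaves \<open>e\<close> unchanged and turns the excess into the integral of
  \<open>w\<close>.\<close>

lemma ramp_integral_close:
  fixes x d e :: real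
  assumes \<mu>: "\<mu> \<in> M_Psi" and d: "0 < d"
  defines "w \<equiv> \<lambda>s. indicator {x..x + d} s / d * max 0 (\<bar>cumul \<mu> s - cumul \<mu> x\<bar> - e)"
  shows "integrable lborel w"
    and "\<bar>signed_integral \<mu> (\<lambda>y. min 1 (max 0 ((x + d - y) / d))) - cumul \<mu> x\<bar>
      \<le> e + (LINT s|lborel. w s)"
proof -
  let ?k = "\<lambda>s. indicator {x..x + d} s / d"
  note I = ramp_integral[OF \<mu> d, of x]
  have k: "integrable lborel ?k" "(LINT s|lborel. ?k s) = 1"
    using d by auto
  have kc: "(LINT s|lborel. ?k s * c) = c" for c
    unfolding integral_mult_left_zero k(2) by simp
  have diff: "integrable lborel (\<lambda>s. ?k s * (cumul \<mu> s - cumul \<mu> x))"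
    using Bochner_Integration.integrable_diff[OF I(1) integrable_mult_left[OF k(1), of "cumul \<mu> x"]]
    by (simp add: right_diff_distrib)
  have diff_e: "integrable lborel (\<lambda>s. \<bar>?k s * (cumul \<mu> s - cumul \<mu> x)\<bar> - ?k s * e)"
    by (intro Bochner_Integration.integrable_diff integrable_abs diff integrable_mult_left k)
  \<comment> \<open>Moving the nonnegative density inside the truncation expresses \<open>w\<close>
    through functions already known to be integrable.\<close>
  have w: "w = (\<lambda>s. max 0 (\<bar>?k s * (cumul \<mu> s - cumul \<mu> x)\<bar> - ?k s * e))"
    using d by (auto simp: w_def fun_eq_iff abs_mult max_def field_simps split: split_indicator)
  show wi: "integrable lborel w"
    unfolding w by (intro integrable_max diff_e) simp
  have "signed_integral \<mu> (\<lambda>y. min 1 (max 0 ((x + d - y) / d))) - cumul \<mu> x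
      = (LINT s|lborel. ?k s * cumul \<mu> s) - (LINT s|lborel. ?k s * cumul \<mu> x)"
    unfolding I(2) kc ..
  also have "\<dots> = (LINT s|lborel. ?k s * (cumul \<mu> s - cumul \<mu> x))"
    using Bochner_Integration.integral_diff[OF I(1) integrable_mult_left[OF k(1), of "cumul \<mu> x"]]
    by (simp add: right_diff_distrib)
  finally have "\<bar>signed_integral \<mu> (\<lambda>y. min 1 (max 0 ((x + d - y) / d))) - cumul \<mu> x\<bar>
      = \<bar>LINT s|lborel. ?k s * (cumul \<mu> s - cumul \<mu> x)\<bar>" by simp
  also have "\<dots> \<le> (LINT s|lborel. ?k s * e + w s)"
  proof (rule order_trans[OF integral_abs_bound integral_mono])
    show "integrable lborel (\<lambda>s. ?k s * e + w s)"
      by (intro Bochner_Integration.integrable_add integrable_mult_left k wi)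
    show "integrable lborel (\<lambda>s. \<bar>?k s * (cumul \<mu> s - cumul \<mu> x)\<bar>)"
      by (intro integrable_abs diff)
  qed (simp add: w)
  also have "\<dots> = (LINT s|lborel. ?k s * e) + (LINT s|lborel. w s)"
    by (intro Bochner_Integration.integral_add integrable_mult_left k wi)
  also have "(LINT s|lborel. ?k s * e) = e"
    by (rule kc)
  finally show "\<bar>signed_integral \<mu> (\<lambda>y. min 1 (max 0 ((x + d - y) / d))) - cumul \<mu> x\<bar>
      \<le> e + (LINT s|lborel. w s)" .
qed

text \<open>Each part is continuous from above along intervals shrinking to \<open>{0..x}\<close>.
  Near \<open>x\<close> both increments lie in \<open>[0, e)\<close>, hence so does the absolute
  value of their difference.\<close>

lemma cumul_right_continuous:
  assumes \<mu>: "\<mu> \<in> M_Psi" and e: "0 < e"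
  obtains h where "0 < h" "\<And>s. x \<le> s \<Longrightarrow> s \<le> x + h \<Longrightarrow> \<bar>cumul \<mu> s - cumul \<mu> x\<bar> < e"
proof -
  have part: "\<forall>\<^sub>F m in sequentially. measure M {0..x + 1 / real (Suc m)} < measure M {0..x} + e"
    if "M = pos_part \<mu> \<or> M = neg_part \<mu>" for M
  proof -
    note R = M_Psi_part_radon[OF \<mu> that]
    have "(\<lambda>m. measure M {0..x + 1 / real (Suc m)}) \<longlonglongrightarrow> measure M (\<Inter>m. {0..x + 1 / real (Suc m)})"
    proof (rule Lim_measure_decseq)
      show "decseq (\<lambda>m. {0..x + 1 / real (Suc m)})"
        by (auto simp: decseq_def frac_le intro: order_trans)
    qed (use radon_measure_interval_sets[OF R] radon_measure_interval_finite[OF R] in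
        \<open>auto simp: less_top\<close>)
    also have "(\<Inter>m. {0..x + 1 / real (Suc m)}) = {0..x}"
    proof (intro equalityI subsetI)
      fix y assume y: "y \<in> (\<Inter>m. {0..x + 1 / real (Suc m)})"
      have "(\<lambda>m. x + 1 / real (Suc m)) \<longlonglongrightarrow> x + 0"
        by (intro tendsto_intros LIMSEQ_Suc lim_1_over_n)
      then have "y \<le> x + 0"
        by (rule LIMSEQ_le_const) (use y in auto)
      with y show "y \<in> {0..x}" by auto
    qed (auto simp: add_increasing2)
    finally show ?thesis
      by (rule order_tendstoD) (use e in simp)
  qed
  obtain m where m: "measure (pos_part \<mu>) {0..x + 1 / real (Suc m)} < measure (pos_part \<mu>) {0..x} + e"
    "measure (neg_part \<mu>) {0..x + 1 / real (Suc m)} < measure (neg_part \<mu>) {0..x} + e"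
    using eventually_conj[OF part[OF disjI1[OF refl]] part[OF disjI2[OF refl]]]
    by (auto simp: eventually_sequentially)
  have mono: "measure M {0..s} \<le> measure M {0..t}"
    if "M = pos_part \<mu> \<or> M = neg_part \<mu>" "s \<le> t" for M s t
    using radon_measure_interval_sets[OF M_Psi_part_radon[OF \<mu> that(1)]] that(2)
      radon_measure_interval_finite[OF M_Psi_part_radon[OF \<mu> that(1)]]
    by (intro measure_mono_fmeasurable) (auto simp: fmeasurable_def)
  show thesis
  proof
    show "0 < 1 / real (Suc m)" by simp
    fix s assume s: "x \<le> s" "s \<le> x + 1 / real (Suc m)"
    show "\<bar>cumul \<mu> s - cumul \<mu> x\<bar> < e"
      using m mono[OF disjI1[OF refl] s(1)] mono[OF disjI2[OF refl] s(1)]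
        mono[OF disjI1[OF refl] s(2)] mono[OF disjI2[OF refl] s(2)]
      unfolding cumul_def by linarith
  qed
qed

text \<open>Three comparisons: \<open>cumul (\<mu>s n) x\<close> with its ramp average by
  right-equicontinuity, that average with the one of \<open>\<mu>\<close> by convergence of
  integrals, and the latter with \<open>cumul \<mu> x\<close> by right-continuity.\<close>

lemma cumul_tendsto_of_laplace:
  assumes \<mu>s: "\<And>n. \<mu>s n \<in> M_Psi" and \<mu>: "\<mu> \<in> M_Psi"
    and bd: "\<And>n. total_laplace (\<mu>s n) 1 \<le> C"
    and lim: "\<And>l. 0 < l \<Longrightarrow> (\<lambda>n. laplace (\<mu>s n) l) \<longlonglongrightarrow> laplace \<mu> l"
    and eq: "right_equicontinuous_at \<mu>s x" and x: "0 \<le> x"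
  shows "(\<lambda>n. cumul (\<mu>s n) x) \<longlonglongrightarrow> cumul \<mu> x"
proof (rule LIMSEQ_I)
  fix r :: real assume r: "0 < r"
  \<comment> \<open>The first comparison costs less than \<open>2 * e\<close> eventually, the other
    two at most \<open>e\<close> each.\<close>
  define e where "e = r / 4"
  have e: "0 < e" using r by (simp add: e_def)
  obtain h where h: "0 < h"
    and h': "\<And>d. 0 < d \<Longrightarrow> d < h \<Longrightarrow> limsup (\<lambda>n. \<bar>\<mu>s n {x<..x + d}\<bar>) \<le> ereal e"
    using eq e unfolding right_equicontinuous_at_def by metis
  obtain h2 where h2: "0 < h2" "\<And>s. x \<le> s \<Longrightarrow> s \<le> x + h2 \<Longrightarrow> \<bar>cumul \<mu> s - cumul \<mu> x\<bar> < e"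
    using cumul_right_continuous[OF \<mu> e, of x] by metis
  \<comment> \<open>Halving yields the strict inequality \<open>d < h\<close> demanded by
    right-equicontinuity.\<close>
  define d where "d = min h h2 / 2"
  have d: "0 < d" "d < h" "d \<le> h2" using h h2(1) by (auto simp: d_def min_def)
  define A where "A \<nu> = signed_integral \<nu> (\<lambda>y. min 1 (max 0 ((x + d - y) / d)))" for \<nu>
  \<comment> \<open>The truncation turns the bound on the upper limit into convergence to 0, as dominated
    convergence requires.\<close>
  define w where "w n s =
    indicator {x..x + d} s / d * max 0 (\<bar>cumul (\<mu>s n) s - cumul (\<mu>s n) x\<bar> - e)" for n s
  have A\<mu>: "\<bar>A \<mu> - cumul \<mu> x\<bar> \<le> e"
  proof -
    \<comment> \<open>On \<open>{x..x + d}\<close> the deviation of \<open>cumul \<mu>\<close> stays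
      below \<open>e\<close>, so the excess vanishes.\<close>
    have "(\<lambda>s. indicator {x..x + d} s / d * max 0 (\<bar>cumul \<mu> s - cumul \<mu> x\<bar> - e)) = (\<lambda>s. 0)"
      using h2(2) d by (fastforce simp: fun_eq_iff max_def split: split_indicator)
    then show ?thesis
      using ramp_integral_close(2)[OF \<mu> d(1), of x e] unfolding A_def by simp
  qed
  have An: "\<bar>A (\<mu>s n) - cumul (\<mu>s n) x\<bar> \<le> e + (LINT s|lborel. w n s)" for n
    unfolding A_def w_def by (rule ramp_integral_close(2)[OF \<mu>s d(1)])
  have "(\<lambda>n. LINT s|lborel. w n s) \<longlonglongrightarrow> integral\<^sup>L lborel (\<lambda>s::real. 0 :: real)"
  proof (rule integral_dominated_convergence)
    \<comment> \<open>By \<open>cumul_le\<close> at rate 1, both values of \<open>cumul\<close> in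
      \<open>w\<close> are at most \<open>exp (x + d) * C\<close> in absolute value, uniformly in
      \<open>n\<close>.\<close>
    show "integrable lborel (\<lambda>s. indicator {x..x + d} s / d * (2 * (exp (x + d) * C)))"
      using d(1) by (intro integrable_mult_left integrable_divide_zero) auto
    show "w n \<in> borel_measurable lborel" for n
      unfolding w_def by (rule borel_measurable_integrable[OF ramp_integral_close(1)[OF \<mu>s d(1)]])
    show "AE s in lborel. (\<lambda>n. w n s) \<longlonglongrightarrow> 0"
      \<comment> \<open>Right-equicontinuity speaks of positive lengths \<open>s - x\<close>, so the
        null point \<open>s = x\<close> is set aside.\<close>
      using AE_lborel_singleton[of "x"]
    proof eventually_elim
      case (elim s)
      show ?case
      proof (cases "s \<in> {x..x + d}")
        case True
        with elim have s: "x < s" "s \<le> x + d" by auto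
        have ls: "limsup (\<lambda>n. \<bar>\<mu>s n {x<..s}\<bar>) \<le> ereal e"
          using h'[of "s - x"] s d by simp
        have "(\<lambda>n. max 0 (\<bar>cumul (\<mu>s n) s - cumul (\<mu>s n) x\<bar> - e)) \<longlonglongrightarrow> 0"
        proof (rule order_tendstoI)
          fix a :: real assume "0 < a"
          then have "limsup (\<lambda>n. \<bar>\<mu>s n {x<..s}\<bar>) < ereal (e + a)"
            using ls by (simp add: le_less_trans)
          from Limsup_lessD[OF this]
          show "\<forall>\<^sub>F n in sequentially. max 0 (\<bar>cumul (\<mu>s n) s - cumul (\<mu>s n) x\<bar> - e) < a"
            by eventually_elim (use \<open>0 < a\<close> s x in \<open>simp add: M_Psi_Ioc[OF \<mu>s] max_def\<close>)
        qed (auto simp: less_max_iff_disj)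
        then have "(\<lambda>n. w n s) \<longlonglongrightarrow> indicator {x..x + d} s / d * 0"
          unfolding w_def by (intro tendsto_mult_left)
        then show ?thesis by simp
      qed (simp add: w_def)
    qed
    show "AE s in lborel. norm (w n s) \<le> indicator {x..x + d} s / d * (2 * (exp (x + d) * C))" for n
    proof (rule AE_I2)
      fix s :: real
      have b: "\<bar>cumul (\<mu>s n) t\<bar> \<le> exp (x + d) * C" if "t \<le> x + d" for t
      proof -
        have "\<bar>cumul (\<mu>s n) t\<bar> \<le> exp (1 * t) * total_laplace (\<mu>s n) 1"
          by (rule cumul_le[OF \<mu>s]) simp
        also have "\<dots> \<le> exp (x + d) * C"
          using that bd[of n] by (intro mult_mono) (auto simp: total_laplace_def)
        finally show ?thesis .
      qed
      show "norm (w n s) \<le> indicator {x..x + d} s / d * (2 * (exp (x + d) * C))"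
      proof (cases "s \<in> {x..x + d}")
        case True
        then have "max 0 (\<bar>cumul (\<mu>s n) s - cumul (\<mu>s n) x\<bar> - e) \<le> 2 * (exp (x + d) * C)"
          using b[of s] b[of x] e d by auto
        then show ?thesis
          using d True by (simp add: w_def divide_right_mono)
      qed (simp add: w_def)
    qed
  qed simp
  then have "\<forall>\<^sub>F n in sequentially. (LINT s|lborel. w n s) < e"
    using e by (auto dest: order_tendstoD)
  moreover have "(\<lambda>n. A (\<mu>s n)) \<longlonglongrightarrow> A \<mu>"
    unfolding A_def
  proof (rule signed_integral_tendsto_compact_support[OF \<mu>s \<mu> bd lim])
    show "min 1 (max 0 ((x + d - y) / d)) = 0" if "x + d \<le> y" for y
      using that d divide_nonpos_pos[of "x + d - y" d] by simp
  qed (use d in \<open>auto intro!: continuous_intros\<close>)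
  then have "\<forall>\<^sub>F n in sequentially. dist (A (\<mu>s n)) (A \<mu>) < e"
    using e by (rule tendstoD)
  ultimately have "\<forall>\<^sub>F n in sequentially. norm (cumul (\<mu>s n) x - cumul \<mu> x) < r"
  proof eventually_elim
    case (elim n)
    then show ?case
      using An[of n] A\<mu> unfolding e_def dist_real_def real_norm_def abs_less_iff abs_le_iff
      by linarith
  qed
  then show "\<exists>N. \<forall>n\<ge>N. norm (cumul (\<mu>s n) x - cumul \<mu> x) < r"
    by (simp add: eventually_sequentially)
qed

section \<open>Uniform bounds from the upper limits, and assembly of both parts\<close>

text \<open>A finite upper limit bounds all but finitely many terms; the sum of the remaining
  nonnegative reals bounds each of them.\<close>

lemma total_laplace_bounded:
  assumes \<mu>s: "\<And>n. \<mu>s n \<in> M_Psi" and l: "0 < l"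
    and ls: "limsup (\<lambda>n. laplace_abs (\<mu>s n) l) < \<infinity>"
  shows "\<exists>C. \<forall>n. total_laplace (\<mu>s n) l \<le> C"
proof -
  obtain B where B: "limsup (\<lambda>n. laplace_abs (\<mu>s n) l) < B" "B < \<infinity>"
    using dense[OF ls] by auto
  from Limsup_lessD[OF B(1)] obtain N where N: "\<And>n. N \<le> n \<Longrightarrow> laplace_abs (\<mu>s n) l < B"
    by (auto simp: eventually_sequentially)
  have "total_laplace (\<mu>s n) l \<le> max (enn2real B) (\<Sum>i<N. total_laplace (\<mu>s i) l)" for n
  proof (cases "N \<le> n")
    case True
    then show ?thesis
      using N[OF True] B(2) by (auto simp: total_laplace_def le_max_iff_disj intro!: enn2real_mono)
  next
    case False
    then show ?thesis
      by (intro max.coboundedI2 member_le_sum) (auto simp: total_laplace_def)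
  qed
  then show ?thesis by blast
qed

theorem theorem2p4:
  fixes \<mu>s :: "nat \<Rightarrow> real set \<Rightarrow> ereal" and \<mu> :: "real set \<Rightarrow> ereal"
  assumes "\<And>n. \<mu>s n \<in> M_Psi"
    and "\<mu> \<in> M_Psi"
    and "\<And>l. l > 0 \<Longrightarrow> limsup (\<lambda>n. laplace_abs (\<mu>s n) l) < \<infinity>"
  shows "((\<forall>l>0. (\<lambda>n. laplace (\<mu>s n) l) \<longlonglongrightarrow> laplace \<mu> l) \<longrightarrow>
           (\<forall>x. continuity_point \<mu> x \<and> right_equicontinuous_at \<mu>s x \<longrightarrow>
              (\<lambda>n. distr_fun (\<mu>s n) x) \<longlonglongrightarrow> distr_fun \<mu> x))
       \<and> ((AE x\<in>{0..} in lborel. (\<lambda>n. distr_fun (\<mu>s n) x) \<longlonglongrightarrow> distr_fun \<mu> x) \<longrightarrow>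
           (\<forall>l>0. (\<lambda>n. laplace (\<mu>s n) l) \<longlonglongrightarrow> laplace \<mu> l))"
proof (intro conjI impI allI; (elim conjE)?)
  have bd: "\<exists>C. \<forall>n. total_laplace (\<mu>s n) l \<le> C" if "0 < l" for l
    using total_laplace_bounded[of \<mu>s] assms that by blast
  show "(\<lambda>n. distr_fun (\<mu>s n) x) \<longlonglongrightarrow> distr_fun \<mu> x"
    if lim: "\<forall>l>0. (\<lambda>n. laplace (\<mu>s n) l) \<longlonglongrightarrow> laplace \<mu> l"
      and c: "continuity_point \<mu> x" and eq: "right_equicontinuous_at \<mu>s x" for x
  proof (cases "x = 0")
    \<comment> \<open>At 0 both distribution functions are 0 by convention, whatever the atoms
      there.\<close>
    case True
    then show ?thesis by (simp add: distr_fun_def)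
  next
    case False
    obtain C where C: "\<And>n. total_laplace (\<mu>s n) 1 \<le> C" using bd[of 1] by auto
    have "0 \<le> x" using c by (simp add: continuity_point_def)
    then have "(\<lambda>n. cumul (\<mu>s n) x) \<longlonglongrightarrow> cumul \<mu> x"
      using cumul_tendsto_of_laplace[of \<mu>s, OF assms(1,2) C _ eq] lim by blast
    then show ?thesis using False by (simp add: distr_fun_eq_cumul assms)
  qed
  show "(\<lambda>n. laplace (\<mu>s n) l) \<longlonglongrightarrow> laplace \<mu> l"
    if "AE x\<in>{0..} in lborel. (\<lambda>n. distr_fun (\<mu>s n) x) \<longlonglongrightarrow> distr_fun \<mu> x" "0 < l" for l
    using that by (intro laplace_tendsto_of_distr_fun assms bd)
qed

end
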